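(* Let $d\ge 1$ be an integer, let $\mathbf{e}_1,\dots,\mathbf{e}_d$ be the standard unit vectors of $\mathbb{R}^d$, and let $C_d\subset\mathbb{R}^d$ be the convex hull of the set \[\{\pm \mathbf{e}_i : 1\le i\le d\}\cup\{\pm(\mathbf{e}_i+\cdots+\mathbf{e}_j): 1\le i<j\le d-1\}\cup\{\pm(2\mathbf{e}_i+\cdots+2\mathbf{e}_{d-1}+\mathbf{e}_d): 1\le i\le d-1\}.\] Let $C_d^*=\{u\in\mathbb{R}^d : \langle u,v\rangle\le 1 \text{ for all } v\in C_d\}$ be its dual polytope. Then for every positive integer $k$, \[|kC_d^*\cap\mathbb{Z}^d|=(k+1)^d+k^d,\] where $kC_d^*=\{k\alpha:\alpha\in C_d^*\}$.
   Context: $\langle\cdot,\cdot\rangle$ denotes the standard inner product on $\mathbb{R}^d$. $C_d$ is called the root polytope of type C. *)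

theory Defs
  imports "HOL-Analysis.Analysis"
begin

text \<open>
  The coordinates of \<open>real ^ 'n\<close> carry no order, while the generators of the polytope depend on
  one. The argument \<open>idx\<close> is meant to be a bijection from \<open>{1..d}\<close> onto the index type \<open>'n\<close>
  naming the \<open>i\<close>-th coordinate.
\<close>

definition unit_vec :: "(nat \<Rightarrow> 'n::finite) \<Rightarrow> nat \<Rightarrow> real ^ 'n" where
  "unit_vec idx i = axis (idx i) 1"

definition C_generators :: "nat \<Rightarrow> (nat \<Rightarrow> 'n::finite) \<Rightarrow> (real ^ 'n) set" where
  "C_generators d idx =
     {s *\<^sub>R unit_vec idx i | s i. s \<in> {1, -1} \<and> 1 \<le> i \<and> i \<le> d} \<union>
     {s *\<^sub>R (\<Sum>l = i..j. unit_vec idx l) | s i j. s \<in> {1, -1} \<and> 1 \<le> i \<and> i < j \<and> j \<le> d - 1} \<union>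
     {s *\<^sub>R ((\<Sum>l = i..d - 1. 2 *\<^sub>R unit_vec idx l) + unit_vec idx d) | s i.
        s \<in> {1, -1} \<and> 1 \<le> i \<and> i \<le> d - 1}"

definition root_polytope_C :: "nat \<Rightarrow> (nat \<Rightarrow> 'n::finite) \<Rightarrow> (real ^ 'n) set" where
  "root_polytope_C d idx = convex hull (C_generators d idx)"

definition dual_polytope :: "'a::real_inner set \<Rightarrow> 'a set" where
  "dual_polytope P = {u. \<forall>v\<in>P. u \<bullet> v \<le> 1}"

definition int_lattice :: "(real ^ 'n::finite) set" where
  "int_lattice = {x. \<forall>i. x $ i \<in> \<int>}"

end

theory Submission imports Defs begin

text \<open>
  For \<open>u\<close> in \<open>\<int>\<^sup>d\<close> put \<open>t\<^sub>i = 2 (u\<^sub>i + \<dots> + u\<^bsub>d-1\<^esub>) + u\<^sub>d\<close>, so that \<open>t\<^sub>d = u\<^sub>d\<close>. Every generator of the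
  polytope is, up to sign, either some \<open>t\<^sub>i\<close> or some \<open>(t\<^sub>i - t\<^sub>j) / 2\<close>, viewed as a linear form in \<open>u\<close>.
  Hence \<open>u\<close> lies in the \<open>k\<close>-th dilate of the dual if and only if \<open>\<bar>t\<^sub>i\<bar> \<le> k\<close> for all \<open>i\<close>: the
  forms of the second kind impose nothing new. The map from \<open>u\<close> to \<open>t\<close> is a bijection
  from \<open>\<int>\<^sup>d\<close> onto the integer vectors whose entries all have the same parity. Of the integers
  in \<open>[-k, k]\<close>, exactly \<open>k + 1\<close> have the parity of \<open>k\<close> and \<open>k\<close> have the other one.
\<close>

section \<open>Duals of convex hulls and their dilates\<close>

text \<open>For fixed \<open>u\<close> the condition \<open>u \<bullet> v \<le> 1\<close> cuts out a
  half-space of \<open>v\<close>, which is convex, so it passes from the generators to their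
  hull.\<close>

lemma dual_polytope_convex_hull: "dual_polytope (convex hull S) = dual_polytope S"
proof
  show "dual_polytope (convex hull S) \<subseteq> dual_polytope S"
    unfolding dual_polytope_def using hull_subset[of S convex] by blast
  show "dual_polytope S \<subseteq> dual_polytope (convex hull S)"
  proof
    fix u assume "u \<in> dual_polytope S"
    then have "S \<subseteq> {v. u \<bullet> v \<le> 1}" by (auto simp: dual_polytope_def)
    then have "convex hull S \<subseteq> {v. u \<bullet> v \<le> 1}"
      by (rule hull_minimal) (rule convex_halfspace_le)
    then show "u \<in> dual_polytope (convex hull S)" by (auto simp: dual_polytope_def)
  qed
qed

lemma scaled_dual_polytope:
  assumes "c > 0"
  shows "(\<lambda>\<alpha>. c *\<^sub>R \<alpha>) ` dual_polytope P = {u. \<forall>v\<in>P. u \<bullet> v \<le> c}"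
proof
  show "(\<lambda>\<alpha>. c *\<^sub>R \<alpha>) ` dual_polytope P \<subseteq> {u. \<forall>v\<in>P. u \<bullet> v \<le> c}"
    using assms by (auto simp: dual_polytope_def)
  show "{u. \<forall>v\<in>P. u \<bullet> v \<le> c} \<subseteq> (\<lambda>\<alpha>. c *\<^sub>R \<alpha>) ` dual_polytope P"
  proof
    fix u assume u: "u \<in> {u. \<forall>v\<in>P. u \<bullet> v \<le> c}"
    have "u = c *\<^sub>R (inverse c *\<^sub>R u)" using assms by simp
    moreover have "inverse c *\<^sub>R u \<in> dual_polytope P"
      using assms u by (auto simp: dual_polytope_def field_simps)
    ultimately show "u \<in> (\<lambda>\<alpha>. c *\<^sub>R \<alpha>) ` dual_polytope P" by blast
  qed
qed

section \<open>Long roots, short roots and the inequalities they give\<close>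

text \<open>The pairing of \<open>u\<close> with the \<open>i\<close>-th long root, written in the
  basis of simple roots. The half-open range makes the sum empty at \<open>i = d\<close>, so the
  long simple root is included.\<close>

definition long_root_form :: "nat \<Rightarrow> (nat \<Rightarrow> 'n::finite) \<Rightarrow> real ^ 'n \<Rightarrow> nat \<Rightarrow> real" where
  "long_root_form d idx u i = 2 * (\<Sum>l = i..<d. u $ idx l) + u $ idx d"

lemma long_root_form_last [simp]: "long_root_form d idx u d = u $ idx d"
  by (simp add: long_root_form_def)

lemma long_root_form_diff:
  assumes "i \<le> Suc j" "Suc j \<le> d"
  shows "long_root_form d idx u i - long_root_form d idx u (Suc j) = 2 * (\<Sum>l = i..j. u $ idx l)"
proof -
  have "(\<Sum>l = i..<d. u $ idx l) = (\<Sum>l = i..<Suc j. u $ idx l) + (\<Sum>l = Suc j..<d. u $ idx l)"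
    using assms by (simp only: sum.atLeastLessThan_concat)
  then show ?thesis by (simp add: long_root_form_def atLeastLessThanSuc_atLeastAtMost)
qed

lemma inner_unit_vec: "u \<bullet> unit_vec idx i = u $ idx i"
  by (simp add: unit_vec_def inner_axis)

lemma inner_long_root:
  assumes "d \<ge> 1"
  shows "u \<bullet> ((\<Sum>l = i..d - 1. 2 *\<^sub>R unit_vec idx l) + unit_vec idx d) = long_root_form d idx u i"
proof -
  have "{i..d - 1} = {i..<d}" using assms by auto
  then show ?thesis
    by (simp add: inner_add_right inner_sum_right inner_unit_vec long_root_form_def sum_distrib_left)
qed

lemma C_generators_le_iff:
  assumes d: "d \<ge> 1"
  shows "(\<forall>v \<in> C_generators d idx. u \<bullet> v \<le> c) \<longleftrightarrow> (\<forall>i\<in>{1..d}. \<bar>long_root_form d idx u i\<bar> \<le> c)"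
    (is "?L \<longleftrightarrow> ?R")
proof
  assume L: ?L
  show ?R
  proof
    fix i assume i: "i \<in> {1..d}"
    have *: "s * long_root_form d idx u i \<le> c" if s: "s \<in> {1, -1}" for s :: real
    proof (cases "i = d")
      \<comment> \<open>The third family of generators stops at \<open>d - 1\<close>; the last long
        root occurs among the unit vectors.\<close>
      case True
      have "s *\<^sub>R unit_vec idx d \<in> C_generators d idx"
        unfolding C_generators_def using s d by blast
      then have "u \<bullet> (s *\<^sub>R unit_vec idx d) \<le> c" using L by blast
      then show ?thesis using True by (simp add: inner_unit_vec)
    next
      case False
      have "s *\<^sub>R ((\<Sum>l = i..d - 1. 2 *\<^sub>R unit_vec idx l) + unit_vec idx d) \<in> C_generators d idx"
      proof -
        have "1 \<le> i \<and> i \<le> d - 1" using i False by auto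
        then show ?thesis unfolding C_generators_def using s by blast
      qed
      then have "u \<bullet> (s *\<^sub>R ((\<Sum>l = i..d - 1. 2 *\<^sub>R unit_vec idx l) + unit_vec idx d)) \<le> c"
        using L by blast
      then show ?thesis by (simp only: inner_scaleR_right inner_long_root[OF d])
    qed
    show "\<bar>long_root_form d idx u i\<bar> \<le> c" using *[of 1] *[of "-1"] by (simp add: abs_le_iff)
  qed
next
  assume R: ?R
  have long: "s * long_root_form d idx u i \<le> c"
    if "s \<in> {1, -1}" "1 \<le> i" "i \<le> d" for s i
    using R that by (fastforce simp: abs_le_iff)
  \<comment> \<open>A short root is half the difference of two long ones, so its bound is the
    average of the bounds for \<open>s\<close> at \<open>i\<close> and \<open>-s\<close> at
    \<open>Suc j\<close>. Allowing \<open>i = j\<close> also covers the unit vectors other than the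
    last.\<close>
  have short: "s * (\<Sum>l = i..j. u $ idx l) \<le> c"
    if "s \<in> {1, -1}" "1 \<le> i" "i \<le> j" "Suc j \<le> d" for s i j
    using long[of s i] long[of "-s" "Suc j"] long_root_form_diff[of i j d idx u] that
    by (auto simp: algebra_simps)
  have unit: "s * u $ idx i \<le> c" if "s \<in> {1, -1}" "1 \<le> i" "i \<le> d" for s i
    using long[of s d] short[of s i i] that by (cases "i = d") simp_all
  show ?L
  proof
    fix v assume "v \<in> C_generators d idx"
    then consider
      (unit) s i where "v = s *\<^sub>R unit_vec idx i" "s \<in> {1, -1}" "1 \<le> i" "i \<le> d"
    | (short) s i j where "v = s *\<^sub>R (\<Sum>l = i..j. unit_vec idx l)" "s \<in> {1, -1}" "1 \<le> i" "i < j"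
        "j \<le> d - 1"
    | (long) s i where "v = s *\<^sub>R ((\<Sum>l = i..d - 1. 2 *\<^sub>R unit_vec idx l) + unit_vec idx d)"
        "s \<in> {1, -1}" "1 \<le> i" "i \<le> d - 1"
      unfolding C_generators_def by blast
    then show "u \<bullet> v \<le> c"
    proof cases
      case e: (unit s i)
      show ?thesis using unit[OF e(2-4)] by (simp add: e(1) inner_unit_vec)
    next
      case s: (short s i j)
      then have "Suc j \<le> d" using d by simp
      then show ?thesis using s short[of s i j]
        by (simp add: inner_sum_right inner_unit_vec)
    next
      case l: (long s i)
      then have "s * long_root_form d idx u i \<le> c" by (intro long) auto
      then show ?thesis unfolding l(1) inner_scaleR_right inner_long_root[OF d] .
    qed
  qed
qed

section \<open>Counting vectors of constant parity\<close>

text \<open>Parity is taken relative to \<open>k\<close>, so the sizes of the two boxes do not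
  depend on whether \<open>k\<close> is even.\<close>

definition parity_box :: "nat \<Rightarrow> nat \<Rightarrow> bool \<Rightarrow> (nat \<Rightarrow> int) set" where
  "parity_box d k b = ({1..d} \<rightarrow>\<^sub>E {x. \<bar>x\<bar> \<le> int k \<and> even (x + int k) = b})"

lemma card_same_parity: "card {x. \<bar>x\<bar> \<le> int k \<and> even (x + int k) = True} = k + 1"
proof -
  \<comment> \<open>Enumerates \<open>-k, -k + 2, ..., k\<close>.\<close>
  have "bij_betw (\<lambda>j. 2 * int j - int k) {..k} {x. \<bar>x\<bar> \<le> int k \<and> even (x + int k) = True}"
    by (rule bij_betwI[where g = "\<lambda>x. nat ((x + int k) div 2)"]) auto
  then show ?thesis by (simp add: bij_betw_same_card[symmetric])
qed

lemma card_opposite_parity: "card {x. \<bar>x\<bar> \<le> int k \<and> even (x + int k) = False} = k"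
proof -
  \<comment> \<open>Enumerates \<open>-k + 1, -k + 3, ..., k - 1\<close>.\<close>
  have "bij_betw (\<lambda>j. 2 * int j + 1 - int k) {..<k} {x. \<bar>x\<bar> \<le> int k \<and> even (x + int k) = False}"
    by (rule bij_betwI[where g = "\<lambda>x. nat ((x + int k) div 2)"]) (auto elim!: oddE)
  then show ?thesis by (simp add: bij_betw_same_card[symmetric])
qed

lemma card_parity_boxes:
  assumes "d \<ge> 1"
  shows "card (parity_box d k True \<union> parity_box d k False) = (k + 1) ^ d + k ^ d"
proof -
  have fin: "finite (parity_box d k b)" for b
  proof -
    have "{x. \<bar>x\<bar> \<le> int k \<and> even (x + int k) = b} \<subseteq> {- int k..int k}" by auto
    then have "finite {x. \<bar>x\<bar> \<le> int k \<and> even (x + int k) = b}" by (rule finite_subset) simp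
    then show ?thesis unfolding parity_box_def by (intro finite_PiE) simp
  qed
  have "parity_box d k True \<inter> parity_box d k False = {}"
  proof -
    \<comment> \<open>Some coordinate must exist to tell the parities apart: for
      \<open>d = 0\<close> both boxes would be the same singleton.\<close>
    have "1 \<in> {1..d}" using assms by simp
    then show ?thesis unfolding parity_box_def PiE_iff by blast
  qed
  then show ?thesis
    using fin by (simp only: card_Un_disjoint)
      (simp only: parity_box_def card_PiE finite_atLeastAtMost card_same_parity card_opposite_parity
        prod_constant card_atLeastAtMost diff_add_inverse2 add_diff_cancel_right' Suc_eq_plus1)
qed

text \<open>Entries share a parity exactly when each is congruent to the last one modulo 2; this
  form of the condition no longer involves \<open>k\<close>.\<close>

lemma parity_boxes_iff:
  assumes "d \<ge> 1"
  shows "t \<in> parity_box d k True \<union> parity_box d k False \<longleftrightarrow>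
    t \<in> extensional {1..d} \<and> (\<forall>i\<in>{1..d}. \<bar>t i\<bar> \<le> int k \<and> even (t i - t d))"
proof -
  have "even (t i - t d) \<longleftrightarrow> even (t i + int k) = even (t d + int k)" for i by auto
  moreover have "d \<in> {1..d}" using assms by simp
  ultimately show ?thesis unfolding parity_box_def Un_iff PiE_iff mem_Collect_eq by metis
qed

section \<open>The bijection with the lattice points\<close>

text \<open>The inverse of the passage from \<open>u\<close> to \<open>t\<close>, obtained by
  solving the triangular system; \<open>inv_into\<close> recovers the position of the coordinate
  \<open>m\<close>.\<close>

definition from_long_root_values :: "nat \<Rightarrow> (nat \<Rightarrow> 'n::finite) \<Rightarrow> (nat \<Rightarrow> int) \<Rightarrow> real ^ 'n" where
  "from_long_root_values d idx t =
     (\<chi> m. let j = inv_into {1..d} idx m in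
       if j < d then real_of_int (t j - t (Suc j)) / 2 else real_of_int (t d))"

lemma from_long_root_values_nth:
  assumes "inj_on idx {1..d}" "j \<in> {1..d}"
  shows "from_long_root_values d idx t $ idx j =
    (if j < d then real_of_int (t j - t (Suc j)) / 2 else real_of_int (t d))"
  using assms by (simp add: from_long_root_values_def)

lemma long_root_form_from_values:
  assumes "inj_on idx {1..d}" "i \<in> {1..d}"
  shows "long_root_form d idx (from_long_root_values d idx t) i = real_of_int (t i)"
proof -
  have "2 * (\<Sum>l = i..<d. from_long_root_values d idx t $ idx l)
      = (\<Sum>l = i..<d. real_of_int (t l) - real_of_int (t (Suc l)))"
    unfolding sum_distrib_left
    using assms by (intro sum.cong) (auto simp: from_long_root_values_nth)
  \<comment> \<open>The sum telescopes; the negated summand turns the differences into the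
    orientation of \<open>sum_Suc_diff'\<close>.\<close>
  also have "\<dots> = real_of_int (t i) - real_of_int (t d)"
    using assms sum_Suc_diff'[of i d "\<lambda>l. - real_of_int (t l)"] by simp
  finally show ?thesis
    using assms by (simp add: long_root_form_def from_long_root_values_nth)
qed

lemma from_values_long_root_form:
  assumes bij: "bij_betw idx {1..d} (UNIV :: 'n::finite set)"
    and t: "\<And>i. i \<in> {1..d} \<Longrightarrow> real_of_int (t i) = long_root_form d idx u i"
  shows "from_long_root_values d idx t = u"
proof (rule vec_eq_iff[THEN iffD2], rule allI)
  fix m :: 'n
  obtain j where j: "j \<in> {1..d}" "m = idx j"
    using bij_betw_imp_surj_on[OF bij] by blast
  have "from_long_root_values d idx t $ idx j = u $ idx j"
    using j t[of j] t[of "Suc j"] long_root_form_diff[of j j d idx u]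
    by (cases "j = d") (auto simp: from_long_root_values_nth[OF bij_betw_imp_inj_on[OF bij]])
  then show "from_long_root_values d idx t $ m = u $ m" using j by simp
qed

text \<open>Equal parity is what makes the half-differences integral; conversely, for integral
  \<open>u\<close> each \<open>t i - t d\<close> is twice an integer.\<close>

lemma from_long_root_values_bij:
  fixes idx :: "nat \<Rightarrow> 'n::finite"
  assumes d: "d \<ge> 1" and bij: "bij_betw idx {1..d} (UNIV :: 'n set)"
  shows "bij_betw (from_long_root_values d idx) (parity_box d k True \<union> parity_box d k False)
    ({u. \<forall>i\<in>{1..d}. \<bar>long_root_form d idx u i\<bar> \<le> real k} \<inter> int_lattice)"
    (is "bij_betw ?g ?T ?L")
proof (rule bij_betwI')
  note inj = bij_betw_imp_inj_on[OF bij]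
  fix t t' assume t: "t \<in> ?T" and t': "t' \<in> ?T"
  show "?g t = ?g t' \<longleftrightarrow> t = t'"
  proof
    assume eq: "?g t = ?g t'"
    show "t = t'"
    proof (rule extensionalityI[where A = "{1..d}"])
      show "t \<in> extensional {1..d}" "t' \<in> extensional {1..d}"
        using t t' parity_boxes_iff[OF d] by blast+
      show "t i = t' i" if "i \<in> {1..d}" for i
        using long_root_form_from_values[OF inj that, of t]
          long_root_form_from_values[OF inj that, of t'] eq by simp
    qed
  qed simp
next
  note inj = bij_betw_imp_inj_on[OF bij]
  fix t assume "t \<in> ?T"
  then have t: "\<bar>t i\<bar> \<le> int k" "even (t i - t d)" if "i \<in> {1..d}" for i
    using that parity_boxes_iff[OF d] by blast+
  have "\<bar>long_root_form d idx (?g t) i\<bar> \<le> real k" if "i \<in> {1..d}" for i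
    using t(1)[OF that] long_root_form_from_values[OF inj that, of t] by linarith
  moreover have "?g t $ m \<in> \<int>" for m
  proof -
    obtain j where j: "j \<in> {1..d}" "m = idx j"
      using bij_betw_imp_surj_on[OF bij] by blast
    show ?thesis
    proof (cases "j < d")
      case True
      \<comment> \<open>Both entries are congruent to \<open>t d\<close> modulo 2.\<close>
      have "even (t j - t (Suc j))"
        using t(2)[of j] t(2)[of "Suc j"] j True by auto
      then obtain n where "t j - t (Suc j) = 2 * n" by blast
      then have "real_of_int (t j - t (Suc j)) / 2 = real_of_int n" by simp
      then show ?thesis
        using True j by (simp only: from_long_root_values_nth[OF inj] if_True Ints_of_int)
    next
      case False
      then show ?thesis using j by (simp add: from_long_root_values_nth[OF inj])
    qed
  qed
  ultimately show "?g t \<in> ?L" by (simp add: int_lattice_def)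
next
  fix u assume u: "u \<in> ?L"
  \<comment> \<open>The floor only changes the type: the coordinates of \<open>u\<close> are
    integers already.\<close>
  define w where "w l = \<lfloor>u $ idx l\<rfloor>" for l
  have w: "real_of_int (w l) = u $ idx l" for l
    using u by (simp add: w_def int_lattice_def)
  \<comment> \<open>The restriction supplies the extensionality that membership in a parity box
    demands.\<close>
  define t where "t = restrict (\<lambda>i. 2 * (\<Sum>l = i..<d. w l) + w d) {1..d}"
  have t: "real_of_int (t i) = long_root_form d idx u i" if "i \<in> {1..d}" for i
    using that by (simp add: t_def long_root_form_def w)
  have "\<bar>t i\<bar> \<le> int k" if "i \<in> {1..d}" for i
  proof -
    have "\<bar>real_of_int (t i)\<bar> \<le> real k" using u that t[OF that] by simp
    then show ?thesis by linarith
  qed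
  moreover have "even (t i - t d)" if "i \<in> {1..d}" for i
    using that by (simp add: t_def)
  ultimately have "t \<in> ?T"
    unfolding parity_boxes_iff[OF d] by (simp add: t_def)
  moreover have "u = ?g t"
    using from_values_long_root_form[OF bij t] by simp
  ultimately show "\<exists>t\<in>?T. u = ?g t" by blast
qed

theorem theorem1:
  fixes d k :: nat and idx :: "nat \<Rightarrow> 'n::finite"
  assumes "d \<ge> 1"
    and "bij_betw idx {1..d} (UNIV :: 'n set)"
    and "k \<ge> 1"
  shows "card ((\<lambda>\<alpha>. real k *\<^sub>R \<alpha>) ` dual_polytope (root_polytope_C d idx) \<inter> int_lattice)
           = (k + 1) ^ d + k ^ d"
proof -
  have "real k > 0" using assms(3) by simp
  then have "(\<lambda>\<alpha>. real k *\<^sub>R \<alpha>) ` dual_polytope (root_polytope_C d idx)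
      = {u. \<forall>i\<in>{1..d}. \<bar>long_root_form d idx u i\<bar> \<le> real k}"
    by (simp only: root_polytope_C_def dual_polytope_convex_hull scaled_dual_polytope
        C_generators_le_iff[OF assms(1)])
  then show ?thesis
    using bij_betw_same_card[OF from_long_root_values_bij[OF assms(1,2), of k]]
      card_parity_boxes[OF assms(1), of k] by simp
qed

end
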